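(* Let $\mathcal I$ and $\mathcal J$ be two ideals on $\mathbb N$. Then: (i) $c_{0,\mathcal I}$ and $c_{0,\mathcal J}$ are $c_0$-disjoint if and only if $\mathcal I\subseteq\mathcal J^\perp$. In particular, $c_{0,\mathcal I}$ and $c_{0,\mathcal I^\perp}$ are $c_0$-disjoint for every ideal $\mathcal I$. (ii) $c_{0,\mathcal I^\perp}=c_0[c_{0,\mathcal I}]$. (iii) $\mathcal I$ is Fréchet if and only if $c_0[c_0[c_{0,\mathcal I}]]=c_{0,\mathcal I}$.
   Context: An ideal on a set $S$ is a collection of subsets of $S$ containing $\emptyset$, closed under taking subsets and under finite unions; it is always assumed to contain every finite subset of $S$ (it need not be proper). For a collection $\mathcal A$ of subsets of $\mathbb N$, $\mathcal A^\perp=\{B\subseteq\mathbb N: A\cap B\text{ is finite for all }A\in\mathcal A\}$. An ideal $\mathcal I$ is Fréchet if $\mathcal I=\mathcal I^{\perp\perp}$. $c_{0,\mathcal I}$ is the space of $(x_n)\in\ell_\infty$ (bounded real sequences) such that $\{n:|x_n|\ge\varepsilon\}\in\mathcal I$ for every $\varepsilon>0$. Elements $x,y\in\ell_\infty$ are $c_0$-disjoint, written $x\perp_{c_0}y$, if $|x|\wedge|y|\in c_0$ (pointwise order). Subspaces $S,T$ of $\ell_\infty$ are $c_0$-disjoint if $s\perp_{c_0}t$ for all $s\in S$, $t\in T$. For a subspace $Y$ of $\ell_\infty$, $c_0[Y]=\{x\in\ell_\infty: x\perp_{c_0}y\text{ for all }y\in Y\}$. *)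

theory Defs
  imports "HOL-Analysis.Analysis"
begin

text \<open>
  Ideals of sets. An ideal contains all finite subsets of the underlying set and is not
  required to be proper.
\<close>

definition ideal_on :: "'a set \<Rightarrow> 'a set set \<Rightarrow> bool" where
  "ideal_on S \<I> \<longleftrightarrow>
     \<I> \<subseteq> Pow S \<and>
     {} \<in> \<I> \<and>
     (\<forall>A\<in>\<I>. \<forall>B. B \<subseteq> A \<longrightarrow> B \<in> \<I>) \<and>
     (\<forall>A\<in>\<I>. \<forall>B\<in>\<I>. A \<union> B \<in> \<I>) \<and>
     (\<forall>F. finite F \<and> F \<subseteq> S \<longrightarrow> F \<in> \<I>)"

definition orth :: "nat set set \<Rightarrow> nat set set" where
  "orth \<A> = {B. \<forall>A\<in>\<A>. finite (A \<inter> B)}"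

definition frechet_ideal :: "nat set set \<Rightarrow> bool" where
  "frechet_ideal \<I> \<longleftrightarrow> ideal_on UNIV \<I> \<and> \<I> = orth (orth \<I>)"

text \<open>
  Since the topology of \<^typ>\<open>nat\<close> is discrete, every sequence is continuous, so the bounded
  continuous functions on \<^typ>\<open>nat\<close> are exactly the bounded sequences (with the sup norm).
\<close>

type_synonym linf = "nat \<Rightarrow>\<^sub>C real"

definition c0 :: "(nat \<Rightarrow> real) set" where
  "c0 = {x. x \<longlonglongrightarrow> 0}"

definition c0_ideal :: "nat set set \<Rightarrow> linf set" where
  "c0_ideal \<I> = {x. \<forall>\<epsilon>>0. {n. \<bar>apply_bcontfun x n\<bar> \<ge> \<epsilon>} \<in> \<I>}"

definition c0_disjoint_elem :: "linf \<Rightarrow> linf \<Rightarrow> bool" where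
  "c0_disjoint_elem x y \<longleftrightarrow> (\<lambda>n. min \<bar>apply_bcontfun x n\<bar> \<bar>apply_bcontfun y n\<bar>) \<in> c0"

text \<open>
  The next two notions are intended for linear subspaces; being a subspace is not part of
  the definitions. The lemmas at the end show that the sets to which they are applied
  are subspaces.
\<close>

definition c0_disjoint :: "linf set \<Rightarrow> linf set \<Rightarrow> bool" where
  "c0_disjoint S T \<longleftrightarrow> (\<forall>s\<in>S. \<forall>t\<in>T. c0_disjoint_elem s t)"

definition c0_compl :: "linf set \<Rightarrow> linf set" where
  "c0_compl Y = {x. \<forall>y\<in>Y. c0_disjoint_elem x y}"

lemma ideal_on_orth: "ideal_on UNIV (orth \<A>)"
  unfolding ideal_on_def orth_def
  by (auto simp: Int_Un_distrib intro: finite_subset[OF Int_mono[OF order_refl]])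

lemma subspace_c0_ideal:
  assumes "ideal_on UNIV \<I>"
  shows "subspace (c0_ideal \<I>)"
proof (rule subspaceI)
  have down: "B \<in> \<I>" if "A \<in> \<I>" "B \<subseteq> A" for A B
    using assms that unfolding ideal_on_def by blast
  have un: "A \<union> B \<in> \<I>" if "A \<in> \<I>" "B \<in> \<I>" for A B
    using assms that unfolding ideal_on_def by blast
  have emp: "{} \<in> \<I>"
    using assms unfolding ideal_on_def by blast
  show "0 \<in> c0_ideal \<I>"
    using emp by (auto simp: c0_ideal_def not_le[symmetric])
  fix x assume x: "x \<in> c0_ideal \<I>"
  show "x + y \<in> c0_ideal \<I>" if y: "y \<in> c0_ideal \<I>" for y
    unfolding c0_ideal_def
  proof (intro CollectI allI impI)
    fix e :: real assume "e > 0"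
    then have "{n. e/2 \<le> \<bar>apply_bcontfun x n\<bar>} \<union> {n. e/2 \<le> \<bar>apply_bcontfun y n\<bar>} \<in> \<I>"
      using x y half_gt_zero[OF \<open>e > 0\<close>] unfolding c0_ideal_def by (intro un) blast+
    then show "{n. e \<le> \<bar>apply_bcontfun (x + y) n\<bar>} \<in> \<I>"
      by (rule down) (auto simp: plus_bcontfun.rep_eq)
  qed
  show "c *\<^sub>R x \<in> c0_ideal \<I>" for c :: real
    unfolding c0_ideal_def
  proof (intro CollectI allI impI)
    fix e :: real assume e: "e > 0"
    show "{n. e \<le> \<bar>apply_bcontfun (c *\<^sub>R x) n\<bar>} \<in> \<I>"
    proof (cases "c = 0")
      case True
      then show ?thesis using e emp by (simp add: scaleR_bcontfun.rep_eq)
    next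
      case False
      then have "{n. e / \<bar>c\<bar> \<le> \<bar>apply_bcontfun x n\<bar>} \<in> \<I>"
        using x e by (auto simp: c0_ideal_def)
      then show ?thesis
        by (rule down) (use False in \<open>auto simp: scaleR_bcontfun.rep_eq abs_mult field_simps\<close>)
    qed
  qed
qed

lemma subspace_c0_compl: "subspace (c0_compl Y)"
proof (rule subspaceI)
  show "0 \<in> c0_compl Y"
    by (auto simp: c0_compl_def c0_disjoint_elem_def c0_def)
  fix x assume x: "x \<in> c0_compl Y"
  show "x + z \<in> c0_compl Y" if z: "z \<in> c0_compl Y" for z
    unfolding c0_compl_def c0_disjoint_elem_def c0_def
  proof (intro CollectI ballI)
    fix y assume y: "y \<in> Y"
    let ?m = "\<lambda>u n. min \<bar>apply_bcontfun u n\<bar> \<bar>apply_bcontfun y n\<bar>"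
    have "?m x \<longlonglongrightarrow> 0" "?m z \<longlonglongrightarrow> 0"
      using x z y by (auto simp: c0_compl_def c0_disjoint_elem_def c0_def)
    then have lim: "(\<lambda>n. ?m x n + ?m z n) \<longlonglongrightarrow> 0"
      using tendsto_add by fastforce
    have "?m (x + z) n \<le> ?m x n + ?m z n" for n
      unfolding plus_bcontfun.rep_eq by linarith
    then show "?m (x + z) \<longlonglongrightarrow> 0"
      by (intro Lim_null_comparison[OF _ lim]) auto
  qed
  show "c *\<^sub>R x \<in> c0_compl Y" for c :: real
    unfolding c0_compl_def c0_disjoint_elem_def c0_def
  proof (intro CollectI ballI)
    fix y assume y: "y \<in> Y"
    let ?m = "\<lambda>u n. min \<bar>apply_bcontfun u n\<bar> \<bar>apply_bcontfun y n\<bar>"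
    have "?m x \<longlonglongrightarrow> 0"
      using x y by (auto simp: c0_compl_def c0_disjoint_elem_def c0_def)
    then have lim: "(\<lambda>n. (\<bar>c\<bar> + 1) * ?m x n) \<longlonglongrightarrow> 0"
      using tendsto_mult_right_zero by blast
    have "?m (c *\<^sub>R x) n \<le> (\<bar>c\<bar> + 1) * ?m x n" for n
    proof (cases "\<bar>apply_bcontfun x n\<bar> \<le> \<bar>apply_bcontfun y n\<bar>")
      case True
      then show ?thesis by (simp add: scaleR_bcontfun.rep_eq abs_mult algebra_simps min_le_iff_disj)
    next
      case False
      then show ?thesis by (simp add: algebra_simps min_le_iff_disj)
    qed
    then show "?m (c *\<^sub>R x) \<longlonglongrightarrow> 0"
      by (intro Lim_null_comparison[OF _ lim]) auto
  qed
qed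

end

theory Submission
  imports Defs
begin

text \<open>
  Indicator functions embed the subsets of \<open>\<nat>\<close> into \<open>\<ell>\<^sub>\<infinity>\<close>, and \<open>A \<in> \<I>\<close> holds exactly if the
  indicator of \<open>A\<close> lies in \<open>c\<^sub>0\<^sub>,\<^sub>\<I>\<close>; hence \<open>\<I> \<mapsto> c\<^sub>0\<^sub>,\<^sub>\<I>\<close> is an order embedding of the ideals. Moreover
  \<open>x\<close> and \<open>y\<close> are \<open>c\<^sub>0\<close>-disjoint exactly if any two superlevel sets of \<open>|x|\<close> and \<open>|y|\<close> for a common
  positive threshold have finite intersection. Testing against indicators gives (ii), and (i)
  and (iii) follow from (ii) and the order embedding.
\<close>

definition chi :: "nat set \<Rightarrow> linf" where
  "chi A = Bcontfun (indicator A)"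

lemma apply_chi [simp]: "apply_bcontfun (chi A) = indicator A"
  unfolding chi_def
proof (rule Bcontfun_inverse)
  have "range (indicator A :: nat \<Rightarrow> real) \<subseteq> {0, 1}"
    by (auto simp: indicator_def)
  then have "bounded (range (indicator A :: nat \<Rightarrow> real))"
    by (meson bounded_subset finite.emptyI finite.insertI finite_imp_bounded)
  then show "(indicator A :: nat \<Rightarrow> real) \<in> bcontfun"
    by (simp add: bcontfun_def)
qed

lemma ideal_on_subset: "\<lbrakk>ideal_on S \<I>; A \<in> \<I>; B \<subseteq> A\<rbrakk> \<Longrightarrow> B \<in> \<I>"
  unfolding ideal_on_def by blast

text \<open>Threshold 1 recovers \<open>A\<close> as a superlevel set of its indicator, and any
  positive threshold gives a subset of \<open>A\<close>.\<close>

lemma chi_in_c0_ideal_iff: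
  assumes "ideal_on UNIV \<I>"
  shows "chi A \<in> c0_ideal \<I> \<longleftrightarrow> A \<in> \<I>"
proof
  assume "chi A \<in> c0_ideal \<I>"
  then have "{n. 1 \<le> \<bar>apply_bcontfun (chi A) n\<bar>} \<in> \<I>"
    unfolding c0_ideal_def by (blast intro: zero_less_one)
  moreover have "{n. 1 \<le> \<bar>apply_bcontfun (chi A) n\<bar>} = A"
    by (auto simp: indicator_def split: if_splits)
  ultimately show "A \<in> \<I>"
    by simp
next
  assume "A \<in> \<I>"
  moreover have "{n. \<epsilon> \<le> \<bar>apply_bcontfun (chi A) n\<bar>} \<subseteq> A" if "\<epsilon> > 0" for \<epsilon>
    using that by (auto simp: indicator_def split: if_splits)
  ultimately show "chi A \<in> c0_ideal \<I>"
    unfolding c0_ideal_def using ideal_on_subset[OF assms] by blast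
qed

lemma c0_ideal_mono: "\<I> \<subseteq> \<J> \<Longrightarrow> c0_ideal \<I> \<subseteq> c0_ideal \<J>"
  unfolding c0_ideal_def by blast

lemma c0_ideal_subset_iff:
  assumes "ideal_on UNIV \<I>" "ideal_on UNIV \<J>"
  shows "c0_ideal \<I> \<subseteq> c0_ideal \<J> \<longleftrightarrow> \<I> \<subseteq> \<J>"
proof
  assume "c0_ideal \<I> \<subseteq> c0_ideal \<J>"
  then show "\<I> \<subseteq> \<J>"
    using assms by (metis chi_in_c0_ideal_iff subset_iff)
qed (rule c0_ideal_mono)

text \<open>A minimum reaches \<epsilon> exactly where both entries do, and a sequence tends to 0
  iff each set where its modulus is at least some \<epsilon> > 0 is finite, the sequential filter
  being the cofinite one.\<close>

lemma c0_disjoint_elem_iff: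
  "c0_disjoint_elem x y \<longleftrightarrow>
    (\<forall>\<epsilon>>0. finite ({n. \<epsilon> \<le> \<bar>apply_bcontfun x n\<bar>} \<inter> {n. \<epsilon> \<le> \<bar>apply_bcontfun y n\<bar>}))"
proof -
  let ?m = "\<lambda>n. min \<bar>apply_bcontfun x n\<bar> \<bar>apply_bcontfun y n\<bar>"
  have "{n. \<not> dist (?m n) 0 < \<epsilon>}
      = {n. \<epsilon> \<le> \<bar>apply_bcontfun x n\<bar>} \<inter> {n. \<epsilon> \<le> \<bar>apply_bcontfun y n\<bar>}" for \<epsilon>
    by (auto simp: dist_real_def)
  then show ?thesis
    by (simp add: c0_disjoint_elem_def c0_def tendsto_iff cofinite_eq_sequentially[symmetric]
        eventually_cofinite)
qed

lemma c0_disjoint_iff_subset: "c0_disjoint S T \<longleftrightarrow> S \<subseteq> c0_compl T"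
  unfolding c0_disjoint_def c0_compl_def by blast

lemma c0_ideal_orth:
  assumes "ideal_on UNIV \<I>"
  shows "c0_ideal (orth \<I>) = c0_compl (c0_ideal \<I>)"
proof (intro equalityI subsetI)
  fix x assume "x \<in> c0_ideal (orth \<I>)"
  \<comment> \<open>For \<open>y\<close> in \<open>c0_ideal \<I>\<close>, the superlevel sets of
    \<open>y\<close> lie in \<I> and those of \<open>x\<close> in \<open>orth \<I>\<close>, so they
    meet in finite sets.\<close>
  then show "x \<in> c0_compl (c0_ideal \<I>)"
    by (auto simp: c0_compl_def c0_disjoint_elem_iff c0_ideal_def orth_def Int_commute)
next
  fix x assume x: "x \<in> c0_compl (c0_ideal \<I>)"
  have "finite (A \<inter> {n. \<epsilon> \<le> \<bar>apply_bcontfun x n\<bar>})" if "\<epsilon> > 0" "A \<in> \<I>" for \<epsilon> A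
  proof -
    have "c0_disjoint_elem x (chi A)"
      using x chi_in_c0_ideal_iff[OF assms] \<open>A \<in> \<I>\<close> by (simp add: c0_compl_def)
    \<comment> \<open>The cap at 1 keeps all of \<open>A\<close> in the superlevel set of its
      indicator; lowering the threshold only enlarges that of \<open>x\<close>.\<close>
    moreover have "min \<epsilon> 1 > 0"
      using \<open>\<epsilon> > 0\<close> by simp
    ultimately have "finite ({n. min \<epsilon> 1 \<le> \<bar>apply_bcontfun x n\<bar>}
        \<inter> {n. min \<epsilon> 1 \<le> \<bar>apply_bcontfun (chi A) n\<bar>})"
      unfolding c0_disjoint_elem_iff by blast
    then show ?thesis
      by (rule rev_finite_subset) (auto simp: min_le_iff_disj)
  qed
  then show "x \<in> c0_ideal (orth \<I>)"
    by (simp add: c0_ideal_def orth_def)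
qed

theorem theorem4p3:
  fixes \<I> \<J> :: "nat set set"
  assumes "ideal_on UNIV \<I>" and "ideal_on UNIV \<J>"
  shows "(c0_disjoint (c0_ideal \<I>) (c0_ideal \<J>) \<longleftrightarrow> \<I> \<subseteq> orth \<J>)
     \<and> c0_disjoint (c0_ideal \<I>) (c0_ideal (orth \<I>))
     \<and> c0_ideal (orth \<I>) = c0_compl (c0_ideal \<I>)
     \<and> (frechet_ideal \<I> \<longleftrightarrow> c0_compl (c0_compl (c0_ideal \<I>)) = c0_ideal \<I>)"
proof -
  \<comment> \<open>Stated for arbitrary \<open>\<K>\<close> because it serves both \<J> and
    \<open>orth \<I>\<close>.\<close>
  have disjoint_iff: "c0_disjoint (c0_ideal \<I>) (c0_ideal \<K>) \<longleftrightarrow> \<I> \<subseteq> orth \<K>"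
    if "ideal_on UNIV \<K>" for \<K>
    using that assms(1)
    by (simp add: c0_disjoint_iff_subset c0_ideal_orth[symmetric] c0_ideal_subset_iff ideal_on_orth)
  have "\<I> \<subseteq> orth (orth \<I>)"
    by (auto simp: orth_def Int_commute)
  then have "c0_disjoint (c0_ideal \<I>) (c0_ideal (orth \<I>))"
    by (simp add: disjoint_iff ideal_on_orth)
  moreover have "c0_compl (c0_compl (c0_ideal \<I>)) = c0_ideal (orth (orth \<I>))"
    using assms(1) by (simp add: c0_ideal_orth ideal_on_orth)
  then have "frechet_ideal \<I> \<longleftrightarrow> c0_compl (c0_compl (c0_ideal \<I>)) = c0_ideal \<I>"
    \<comment> \<open>The order embedding, applied in both directions, turns equality of the spaces
      into equality of the ideals.\<close>
    using assms(1) c0_ideal_subset_iff ideal_on_orth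
    unfolding frechet_ideal_def by (metis subset_antisym subset_refl)
  ultimately show ?thesis
    using disjoint_iff assms c0_ideal_orth by blast
qed

end
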